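(* Let $A$ and $B$ be finite conjunctions of weak linear inequalities $0\le t$ over the rationals, and let $P$ be an $\mathcal{LA}(\mathbb Q)$-proof of unsatisfiability of $A\wedge B$. Let $P'$ be obtained from $P$ by replacing each leaf inequality of $B$ with $(0\le 0)$. Associate to each node of $P'$ a list of pairs $\langle c, 0\le s\rangle$ (coefficient, inequality) as follows: a leaf with atom $0\le s$ gets the list $\langle 1, 0\le s\rangle$; for an inner node obtained by combining premises with lists $l_1,l_2$ using coefficients $c_1,c_2$, (1) concatenate $l_1$ and $l_2$, (2) multiply the coefficient of each pair coming from $l_1$ by $c_1$ and of each pair coming from $l_2$ by $c_2$, and (3) while there is an $A$-local variable $x$ occurring in the inequalities of more than one pair, remove all pairs $\langle c'_i, 0\le s_i\rangle$ whose inequality contains $x$ and add the single pair $\langle 1, 0\le \sum_i c'_i s_i\rangle$. Let $\langle c_1, 0\le t_1\rangle,\dots,\langle c_n,0\le t_n\rangle$ be the list associated with the root of $P'$. Then $I = \bigwedge_{i=1}^n (0\le t_i)$ is an interpolant for $(A,B)$. Moreover, $I$ is stronger than or equal to the interpolant obtained by the standard proof-based method from the same proof, i.e. $I$ entails it.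
   Context: An $\mathcal{LA}(\mathbb Q)$-proof of unsatisfiability is a derivation tree whose leaves are input atoms, whose inner nodes are obtained by the rule "from $0\le t_1$ and $0\le t_2$ derive $0\le c_1 t_1 + c_2 t_2$ with rational $c_1,c_2>0$", and whose root is $0\le c$ for a negative constant $c$. A variable is $A$-local if it occurs in $A$ but not in $B$. An interpolant for $(A,B)$ is a formula $I$ with $A\models I$, $I\wedge B$ unsatisfiable over $\mathbb Q$, and all variables of $I$ occurring in both $A$ and $B$. The standard proof-based method returns the single inequality at the root of $P'$. *)

theory Defs
  imports Complex_Main "HOL-Library.Poly_Mapping" "HOL-Library.Product_Plus"
begin

text \<open>
  A linear term is a pair of its constant part and its finitely supported coefficient function,
  that is, a term in normal form: like monomials are collected, and a variable occurs in it iff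
  its coefficient is nonzero. The inequality \<open>0 \<le> t\<close> is represented by \<open>t\<close>. Addition and the
  zero term are those of the product type.
\<close>

type_synonym 'v lterm = "rat \<times> ('v \<Rightarrow>\<^sub>0 rat)"

definition scale :: "rat \<Rightarrow> 'v lterm \<Rightarrow> 'v lterm" where
  "scale c t = (c * fst t, Poly_Mapping.map ((*) c) (snd t))"

definition lvars :: "'v lterm \<Rightarrow> 'v set" where
  "lvars t = Poly_Mapping.keys (snd t)"

definition leval :: "('v \<Rightarrow> rat) \<Rightarrow> 'v lterm \<Rightarrow> rat" where
  "leval \<nu> t = fst t + (\<Sum>x\<in>Poly_Mapping.keys (snd t). Poly_Mapping.lookup (snd t) x * \<nu> x)"

text \<open>Truth, disjunction and the other connectives are expressible, e.g. truth as \<open>Conj []\<close>.\<close>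

datatype 'v fm = Ineq "'v lterm" | Neg "'v fm" | Conj "'v fm list"

fun sat :: "('v \<Rightarrow> rat) \<Rightarrow> 'v fm \<Rightarrow> bool" where
  "sat \<nu> (Ineq t) \<longleftrightarrow> 0 \<le> leval \<nu> t"
| "sat \<nu> (Neg F) \<longleftrightarrow> \<not> sat \<nu> F"
| "sat \<nu> (Conj Fs) \<longleftrightarrow> (\<forall>F\<in>set Fs. sat \<nu> F)"

fun fvars :: "'v fm \<Rightarrow> 'v set" where
  "fvars (Ineq t) = lvars t"
| "fvars (Neg F) = fvars F"
| "fvars (Conj Fs) = (\<Union>F\<in>set Fs. fvars F)"

definition entails :: "'v fm \<Rightarrow> 'v fm \<Rightarrow> bool" where
  "entails F G \<longleftrightarrow> (\<forall>\<nu>. sat \<nu> F \<longrightarrow> sat \<nu> G)"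

definition unsat :: "'v fm \<Rightarrow> bool" where
  "unsat F \<longleftrightarrow> \<not> (\<exists>\<nu>. sat \<nu> F)"

definition interpolant :: "'v fm \<Rightarrow> 'v fm \<Rightarrow> 'v fm \<Rightarrow> bool" where
  "interpolant F G I \<longleftrightarrow> entails F I \<and> unsat (Conj [I, G]) \<and> fvars I \<subseteq> fvars F \<inter> fvars G"

definition local_vars :: "'v fm \<Rightarrow> 'v fm \<Rightarrow> 'v set" where
  "local_vars F G = fvars F - fvars G"

definition conj_ineqs :: "'v lterm list \<Rightarrow> 'v fm" where
  "conj_ineqs ts = Conj (map Ineq ts)"


text \<open>
  The inequality at an inner node is determined by the rule, so trees store only the leaves and
  the coefficients, and \<open>concl\<close> computes the inequality at the root.
\<close>

datatype (leaves: 'a) la_tree = Leaf 'a | Comb rat "'a la_tree" rat "'a la_tree"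
  for map: map_leaves

fun concl :: "'v lterm la_tree \<Rightarrow> 'v lterm" where
  "concl (Leaf t) = t"
| "concl (Comb c\<^sub>1 P\<^sub>1 c\<^sub>2 P\<^sub>2) = scale c\<^sub>1 (concl P\<^sub>1) + scale c\<^sub>2 (concl P\<^sub>2)"

fun pos_coeffs :: "'a la_tree \<Rightarrow> bool" where
  "pos_coeffs (Leaf t) \<longleftrightarrow> True"
| "pos_coeffs (Comb c\<^sub>1 P\<^sub>1 c\<^sub>2 P\<^sub>2) \<longleftrightarrow> c\<^sub>1 > 0 \<and> c\<^sub>2 > 0 \<and> pos_coeffs P\<^sub>1 \<and> pos_coeffs P\<^sub>2"

definition unsat_proof :: "'v lterm set \<Rightarrow> 'v lterm la_tree \<Rightarrow> bool" where
  "unsat_proof S P \<longleftrightarrow> leaves P \<subseteq> S \<and> pos_coeffs P \<and> (\<exists>c<0. concl P = (c, 0))"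

definition erase_leaves :: "'v lterm set \<Rightarrow> 'v lterm la_tree \<Rightarrow> 'v lterm la_tree" where
  "erase_leaves S P = map_leaves (\<lambda>t. if t \<in> S then 0 else t) P"

definition standard_interpolant :: "'v lterm list \<Rightarrow> 'v lterm la_tree \<Rightarrow> 'v fm" where
  "standard_interpolant B P = Ineq (concl (erase_leaves (set B) P))"


type_synonym 'v pairs = "(rat \<times> 'v lterm) list"

definition scale_pairs :: "rat \<Rightarrow> 'v pairs \<Rightarrow> 'v pairs" where
  "scale_pairs c l = map (\<lambda>(c', s). (c * c', s)) l"

definition containing :: "'v \<Rightarrow> 'v pairs \<Rightarrow> 'v pairs" where
  "containing x l = filter (\<lambda>(c, s). x \<in> lvars s) l"

definition not_containing :: "'v \<Rightarrow> 'v pairs \<Rightarrow> 'v pairs" where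
  "not_containing x l = filter (\<lambda>(c, s). x \<notin> lvars s) l"

text \<open>One iteration of the loop, for a set \<open>L\<close> of local variables; which of the eligible
  variables is treated is left open.\<close>

inductive merge_step :: "'v set \<Rightarrow> 'v pairs \<Rightarrow> 'v pairs \<Rightarrow> bool" for L where
  "x \<in> L \<Longrightarrow> length (containing x l) > 1 \<Longrightarrow>
   merge_step L l
     (not_containing x l @ [(1, \<Sum>(c, s)\<leftarrow>containing x l. scale c s)])"

definition merge_loop :: "'v set \<Rightarrow> 'v pairs \<Rightarrow> 'v pairs \<Rightarrow> bool" where
  "merge_loop L l l' \<longleftrightarrow> (merge_step L)\<^sup>*\<^sup>* l l' \<and> \<not> (\<exists>l''. merge_step L l' l'')"

text \<open>A relation because of the choices in the loop: \<open>node_list L P l\<close> holds iff \<open>l\<close> is a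
  possible list for the root of \<open>P\<close>.\<close>

inductive node_list :: "'v set \<Rightarrow> 'v lterm la_tree \<Rightarrow> 'v pairs \<Rightarrow> bool" for L where
  leaf: "node_list L (Leaf s) [(1, s)]"
| inner: "node_list L P\<^sub>1 l\<^sub>1 \<Longrightarrow> node_list L P\<^sub>2 l\<^sub>2 \<Longrightarrow>
    merge_loop L (scale_pairs c\<^sub>1 l\<^sub>1 @ scale_pairs c\<^sub>2 l\<^sub>2) l \<Longrightarrow>
    node_list L (Comb c\<^sub>1 P\<^sub>1 c\<^sub>2 P\<^sub>2) l"

text \<open>The loop terminates whatever choices are made, so every proof tree has a list.\<close>

lemma merge_step_length: "merge_step L l l' \<Longrightarrow> length l' < length l"
proof (induction rule: merge_step.induct)
  case (1 x l)
  have "length (containing x l) + length (not_containing x l) = length l"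
    unfolding containing_def not_containing_def
    using sum_length_filter_compl[of "\<lambda>(c, s). x \<in> lvars s" l]
    by (simp add: case_prod_unfold)
  then show ?case using 1 by simp
qed

lemma merge_loop_exists: "\<exists>l'. merge_loop L l l'"
proof (induction "length l" arbitrary: l rule: less_induct)
  case less
  show ?case
  proof (cases "\<exists>l''. merge_step L l l''")
    case True
    then obtain l'' where st: "merge_step L l l''" by blast
    from less[OF merge_step_length[OF st]] obtain l' where "merge_loop L l'' l'" by blast
    then show ?thesis using st unfolding merge_loop_def
      by (meson converse_rtranclp_into_rtranclp)
  next
    case False
    then show ?thesis unfolding merge_loop_def by blast
  qed
qed

lemma node_list_exists: "\<exists>l. node_list L P l"
proof (induction P)
  case (Leaf s)
  show ?case using node_list.leaf by blast
next
  case (Comb c\<^sub>1 P\<^sub>1 c\<^sub>2 P\<^sub>2)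
  then show ?case using node_list.inner merge_loop_exists by metis
qed

end

theory Submission
  imports Defs
begin

text \<open>
  Each step of the loop preserves the weighted sum of the list, so the list at the root of the
  tree \<open>P'\<close> sums up to its conclusion \<open>t\<close>. Hence the conjunction of its inequalities entails
  \<open>0 \<le> t\<close>, the standard interpolant, and is as such inconsistent with \<open>B\<close>. All inequalities in
  the list are positive combinations of atoms of \<open>A\<close>, so \<open>A\<close> entails them. Finally, when the loop
  ends, an \<open>A\<close>-local variable occurs in at most one pair; an occurrence could not cancel in the
  weighted sum \<open>t\<close>, but \<open>t\<close> has no \<open>A\<close>-local variable, as it differs from a constant by a
  combination of atoms of \<open>B\<close>.
\<close>

abbreviation coeff :: "'v lterm \<Rightarrow> 'v \<Rightarrow> rat" where
  "coeff t \<equiv> Poly_Mapping.lookup (snd t)"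

lemma coeff_scale [simp]: "coeff (scale c t) x = c * coeff t x"
  by (simp add: scale_def Poly_Mapping.map.rep_eq when_def)

lemma fst_scale [simp]: "fst (scale c t) = c * fst t"
  by (simp add: scale_def)

declare lookup_add [simp]

lemma lterm_eqI: "fst s = fst t \<Longrightarrow> (\<And>x. coeff s x = coeff t x) \<Longrightarrow> s = t"
  by (simp add: prod_eq_iff poly_mapping_eqI)

lemma in_lvars_iff: "x \<in> lvars t \<longleftrightarrow> coeff t x \<noteq> 0"
  by (simp add: lvars_def in_keys_iff)

lemma finite_lvars [simp]: "finite (lvars t)"
  by (simp add: lvars_def)

lemma scale_0_right [simp]: "scale c 0 = 0"
  and scale_1 [simp]: "scale 1 t = t"
  and scale_add: "scale c (s + t) = scale c s + scale c t"
  and scale_scale: "scale c (scale d t) = scale (c * d) t"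
  by (auto intro!: lterm_eqI simp: algebra_simps)

lemma lvars_0 [simp]: "lvars 0 = {}"
  by (simp add: lvars_def)

lemma lvars_add: "lvars (s + t) \<subseteq> lvars s \<union> lvars t"
  by (auto simp: in_lvars_iff)

lemma lvars_scale: "lvars (scale c t) \<subseteq> lvars t"
  by (auto simp: in_lvars_iff)

text \<open>Cancellation can make the variables of a sum fewer than those of its summands. With one
  common finite index set for all terms, linearity of \<open>leval\<close> becomes linearity of
  finite sums.\<close>

lemma leval_superset:
  assumes "finite V" "lvars t \<subseteq> V"
  shows "leval \<nu> t = fst t + (\<Sum>x\<in>V. coeff t x * \<nu> x)"
  unfolding leval_def using assms
  by (auto simp: lvars_def in_keys_iff intro!: sum.mono_neutral_left)

lemma leval_0 [simp]: "leval \<nu> 0 = 0"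
  by (simp add: leval_def)

lemma leval_add [simp]: "leval \<nu> (s + t) = leval \<nu> s + leval \<nu> t"
proof -
  have fin: "finite (lvars s \<union> lvars t)" by simp
  show ?thesis
    by (simp add: leval_superset[OF fin lvars_add] leval_superset[OF fin Un_upper1]
        leval_superset[OF fin Un_upper2] distrib_right sum.distrib)
qed

lemma leval_scale [simp]: "leval \<nu> (scale c t) = c * leval \<nu> t"
  by (simp add: leval_superset[OF finite_lvars lvars_scale[of c t]]
      leval_superset[OF finite_lvars order_refl[of "lvars t"]] sum_distrib_left algebra_simps)

definition weighted_sum :: "'v pairs \<Rightarrow> 'v lterm" where
  "weighted_sum l = (\<Sum>(c, s)\<leftarrow>l. scale c s)"

lemma weighted_sum_simps [simp]:
  "weighted_sum [] = 0"
  "weighted_sum ((c, s) # l) = scale c s + weighted_sum l"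
  "weighted_sum (l @ l') = weighted_sum l + weighted_sum l'"
  by (simp_all add: weighted_sum_def)

lemma weighted_sum_scale_pairs: "weighted_sum (scale_pairs c l) = scale c (weighted_sum l)"
  unfolding scale_pairs_def
  by (induction l) (auto simp: scale_add scale_scale)

lemma weighted_sum_partition:
  "weighted_sum (not_containing x l) + weighted_sum (containing x l) = weighted_sum l"
  unfolding containing_def not_containing_def
  by (induction l) (auto simp: algebra_simps)

text \<open>A pair whose term lacks \<open>x\<close> contributes coefficient 0.\<close>

lemma coeff_weighted_sum_partition:
  "coeff (weighted_sum l) x = coeff (weighted_sum (containing x l)) x"
proof -
  have "coeff (weighted_sum (not_containing x l)) x = 0"
    unfolding not_containing_def by (induction l) (auto simp: in_lvars_iff)
  then show ?thesis
    using weighted_sum_partition[of x l, symmetric] by simp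
qed

lemma leval_weighted_sum_nonneg:
  "\<forall>(c, s)\<in>set l. 0 < c \<and> 0 \<le> leval \<nu> s \<Longrightarrow> 0 \<le> leval \<nu> (weighted_sum l)"
  by (induction l) auto

text \<open>A step only regroups summands: the merged pair has coefficient 1 and its term is the
  weighted sum of the removed pairs.\<close>

lemma merge_loop_weighted_sum:
  assumes "merge_loop L l l'"
  shows "weighted_sum l' = weighted_sum l"
proof -
  have "(merge_step L)\<^sup>*\<^sup>* l l'" using assms by (simp add: merge_loop_def)
  then show ?thesis
  proof induction
    case (step l' l'')
    from step.hyps(2) have "weighted_sum l'' = weighted_sum l'"
    proof cases
      case (1 x)
      then show ?thesis
        using weighted_sum_partition[of x l'] by (simp add: weighted_sum_def)
    qed
    with step.IH show ?case by simp
  qed simp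
qed

lemma node_list_weighted_sum: "node_list L T l \<Longrightarrow> weighted_sum l = concl T"
  by (induction rule: node_list.induct)
     (simp_all add: merge_loop_weighted_sum weighted_sum_scale_pairs)

text \<open>Otherwise a step for \<open>x\<close> would still be possible at
  \<open>l'\<close>.\<close>

lemma merge_loop_local: "merge_loop L l l' \<Longrightarrow> x \<in> L \<Longrightarrow> length (containing x l') \<le> 1"
  unfolding merge_loop_def by (meson merge_step.intros not_less)

text \<open>No induction is required: a leaf has a single pair, and the list of an inner node is the
  result of a finished loop.\<close>

lemma node_list_local:
  assumes "node_list L T l" "x \<in> L"
  shows "length (containing x l) \<le> 1"
  using assms by cases (auto simp: containing_def dest: merge_loop_local)

text \<open>This abstracts the closure properties behind both being entailed by \<open>A\<close> and
  having only variables of \<open>A\<close>, so that one induction covers both. As scaling is by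
  positive factors, \<open>0\<close> is demanded separately; it is the empty weighted sum.\<close>

definition lcone :: "'v lterm set \<Rightarrow> bool" where
  "lcone C \<longleftrightarrow> 0 \<in> C \<and> (\<forall>s\<in>C. \<forall>t\<in>C. s + t \<in> C) \<and> (\<forall>c>0. \<forall>s\<in>C. scale c s \<in> C)"

lemma weighted_sum_in_cone:
  "lcone C \<Longrightarrow> set l \<subseteq> {0<..} \<times> C \<Longrightarrow> weighted_sum l \<in> C"
  by (induction l) (auto simp: lcone_def)

lemma merge_loop_in_cone:
  assumes "merge_loop L l l'" "lcone C" "set l \<subseteq> {0<..} \<times> C"
  shows "set l' \<subseteq> {0<..} \<times> C"
proof -
  have "(merge_step L)\<^sup>*\<^sup>* l l'" using assms(1) by (simp add: merge_loop_def)
  then show ?thesis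
  proof induction
    case (step l' l'')
    from step.hyps(2) show ?case
    proof cases
      case (1 x)
      have "set (containing x l') \<subseteq> {0<..} \<times> C" "set (not_containing x l') \<subseteq> {0<..} \<times> C"
        using step.IH by (auto simp: containing_def not_containing_def)
      then show ?thesis
        using weighted_sum_in_cone[OF assms(2)] 1 by (simp add: weighted_sum_def)
    qed
  qed (use assms(3) in simp)
qed

lemma node_list_in_cone:
  assumes "node_list L T l" "lcone C" "pos_coeffs T" "leaves T \<subseteq> C"
  shows "set l \<subseteq> {0<..} \<times> C"
  using assms(1,3,4)
proof induction
  case (inner P\<^sub>1 l\<^sub>1 P\<^sub>2 l\<^sub>2 c\<^sub>1 c\<^sub>2 l)
  have "set (scale_pairs c\<^sub>1 l\<^sub>1 @ scale_pairs c\<^sub>2 l\<^sub>2) \<subseteq> {0<..} \<times> C"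
    using inner by (fastforce simp: scale_pairs_def)
  then show ?case
    using merge_loop_in_cone[OF inner.hyps(3) assms(2)] by blast
qed simp

text \<open>The pair \<open>(c, s)\<close> is the only one containing \<open>x\<close>, so nothing
  can cancel its nonzero contribution to the coefficient of \<open>x\<close> in the weighted sum,
  which is the conclusion of \<open>T\<close>.\<close>

lemma node_list_lvars:
  assumes "node_list L T l" "lcone C" "pos_coeffs T" "leaves T \<subseteq> C"
    and "(c, s) \<in> set l" "x \<in> lvars s" "x \<in> L"
  shows "x \<in> lvars (concl T)"
proof -
  have "c > 0" using node_list_in_cone[OF assms(1-4)] assms(5) by auto
  have mem: "(c, s) \<in> set (containing x l)" using assms(5,6) by (auto simp: containing_def)
  with node_list_local[OF assms(1,7)] have "containing x l = [(c, s)]"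
    by (cases "containing x l") auto
  then have "coeff (weighted_sum l) x = c * coeff s x"
    by (simp add: coeff_weighted_sum_partition)
  with \<open>c > 0\<close> assms(6) show ?thesis
    by (simp add: in_lvars_iff node_list_weighted_sum[OF assms(1)])
qed

lemma pos_coeffs_erase [simp]: "pos_coeffs (erase_leaves S P) = pos_coeffs P"
  unfolding erase_leaves_def by (induction P) auto

text \<open>Putting 0 for a leaf of nonnegative value cannot increase the value, and positive
  coefficients carry this bound to the root.\<close>

lemma leval_concl_erase:
  "pos_coeffs P \<Longrightarrow> \<forall>t\<in>S. 0 \<le> leval \<nu> t \<Longrightarrow>
    leval \<nu> (concl (erase_leaves S P)) \<le> leval \<nu> (concl P)"
  unfolding erase_leaves_def by (induction P) (auto intro!: add_mono)

text \<open>At \<open>x\<close>, an erased leaf has coefficient 0, as does the term 0 that replaces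
  it.\<close>

lemma coeff_concl_erase:
  "\<forall>t\<in>S. x \<notin> lvars t \<Longrightarrow> coeff (concl (erase_leaves S P)) x = coeff (concl P) x"
  unfolding erase_leaves_def by (induction P) (auto simp: in_lvars_iff)

lemma sat_conj_ineqs [simp]: "sat \<nu> (conj_ineqs ts) \<longleftrightarrow> (\<forall>t\<in>set ts. 0 \<le> leval \<nu> t)"
  by (simp add: conj_ineqs_def)

lemma fvars_conj_ineqs [simp]: "fvars (conj_ineqs ts) = (\<Union>t\<in>set ts. lvars t)"
  by (simp add: conj_ineqs_def)

lemma lcone_consequences: "lcone {s. entails F (Ineq s) \<and> lvars s \<subseteq> V}"
  by (simp add: lcone_def entails_def order_trans[OF lvars_add] order_trans[OF lvars_scale])

theorem mainTheorem5:
  fixes A B :: "'v lterm list" and P :: "'v lterm la_tree" and l :: "'v pairs"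
  assumes "unsat_proof (set A \<union> set B) P"
    and "node_list (local_vars (conj_ineqs A) (conj_ineqs B)) (erase_leaves (set B) P) l"
  shows "interpolant (conj_ineqs A) (conj_ineqs B) (conj_ineqs (map snd l))
    \<and> entails (conj_ineqs (map snd l)) (standard_interpolant B P)"
proof -
  let ?A = "conj_ineqs A" and ?B = "conj_ineqs B" and ?I = "conj_ineqs (map snd l)"
  let ?P' = "erase_leaves (set B) P"
  let ?C = "{s. entails ?A (Ineq s) \<and> lvars s \<subseteq> fvars ?A}"
  obtain c where P: "leaves P \<subseteq> set A \<union> set B" "pos_coeffs P" "c < 0" "concl P = (c, 0)"
    using assms(1) by (auto simp: unsat_proof_def)
  \<comment> \<open>A leaf that is not erased is an atom of \<open>A\<close>; an erased one is 0,
    which has no variables and gives a valid inequality.\<close>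
  have "leaves ?P' \<subseteq> ?C"
    using P(1) by (auto simp: erase_leaves_def la_tree.set_map entails_def)
  note cone = assms(2) lcone_consequences _ this
  have l: "set l \<subseteq> {0<..} \<times> ?C"
    by (rule node_list_in_cone[OF cone]) (simp add: P)
  have standard: "entails ?I (standard_interpolant B P)"
    unfolding entails_def
  proof (intro allI impI)
    fix \<nu> assume "sat \<nu> ?I"
    then have "\<forall>(c, s)\<in>set l. 0 < c \<and> 0 \<le> leval \<nu> s" using l by fastforce
    then show "sat \<nu> (standard_interpolant B P)"
      using leval_weighted_sum_nonneg
      by (fastforce simp: standard_interpolant_def node_list_weighted_sum[OF assms(2)])
  qed
  have "entails ?A ?I"
    using l by (fastforce simp: entails_def)
  moreover have "unsat (Conj [?I, ?B])"
    unfolding unsat_def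
  proof
    assume "\<exists>\<nu>. sat \<nu> (Conj [?I, ?B])"
    then obtain \<nu> where \<nu>: "sat \<nu> ?I" "sat \<nu> ?B" by auto
    have "0 \<le> leval \<nu> (concl ?P')"
      using standard \<nu>(1) by (simp add: entails_def standard_interpolant_def)
    also have "\<dots> \<le> leval \<nu> (concl P)"
      using leval_concl_erase[OF P(2)] \<nu>(2) by simp
    also have "\<dots> = c" by (simp add: P(4) leval_def)
    finally show False using P(3) by simp
  qed
  moreover have "fvars ?I \<subseteq> fvars ?A \<inter> fvars ?B"
  proof
    fix x assume "x \<in> fvars ?I"
    then obtain d s where s: "(d, s) \<in> set l" "x \<in> lvars s" by auto
    have A: "x \<in> fvars ?A" using l s by auto
    have "x \<in> fvars ?B"
    proof (rule ccontr)
      assume B: "x \<notin> fvars ?B"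
      with A have "x \<in> local_vars ?A ?B" by (simp add: local_vars_def)
      then have "x \<in> lvars (concl ?P')"
        using node_list_lvars[OF cone s] P(2) by simp
      \<comment> \<open>Erasing atoms of \<open>B\<close> leaves the coefficient of \<open>x\<close>
        unchanged, and it is 0 in the constant conclusion of \<open>P\<close>.\<close>
      then show False
        using B coeff_concl_erase[of "set B" x P] by (simp add: in_lvars_iff P(4))
    qed
    with A show "x \<in> fvars ?A \<inter> fvars ?B" by simp
  qed
  ultimately show ?thesis using standard by (simp add: interpolant_def)
qed

end
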